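(* Let $\dagger : \mathbb{G}(P)\times \mathcal{L}_0(P) \rightarrow \mathbb{G}(P)$ be a relevant P-graph transformation. Suppose that for every P-graph $G = \langle \Phi, \prec\rangle$ and every propositional formula $\varphi \in \mathcal{L}_0(P)$, the P-graph $\dagger(G,\varphi)= \langle \Phi_\dagger, \prec_\dagger\rangle$ satisfies the following condition: for all $\xi \in \Phi_\dagger$, either $\xi \equiv \varphi$, or there is some $\xi' \in \Phi$ such that (a) $\varphi \wedge \xi' \vdash \xi$, (b) $\neg\varphi \wedge \xi \vdash \xi'$, and (c) for all $\psi' \in \Phi$, if $\psi' \prec \xi'$ then there is $\psi \in \Phi_\dagger$ such that $\varphi \wedge \psi' \vdash \psi$, $\neg\varphi \wedge \psi \vdash \psi'$ and $\psi\prec_\dagger \xi$. Then $\dagger$ satisfies DP-4; that is, for every dynamic operator $\star$ induced by $\dagger$, every preference model $M=\langle W,\leq,v\rangle$ that is induced by some P-graph, every $\varphi\in\mathcal{L}_0(P)$, writing $\star(M,\varphi)=\langle W,\leq_{\star\varphi},v\rangle$, and all $w,w'\in W$ with $w\vDash\varphi$ and $w'\not\vDash\varphi$: if $w\leq w'$ then $w\leq_{\star\varphi} w'$.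
   Context: $P$ is a countable set of propositional symbols and $\mathcal{L}_0(P)$ is the set of classical propositional formulas over $P$; $\equiv$ is classical logical equivalence and $\vdash$ is classical entailment. P-graph: a pair $G=\langle\Phi,\prec\rangle$ with $\Phi\subseteq\mathcal{L}_0(P)$ and $\prec$ a strict partial order on $\Phi$. $\mathbb{G}(P)$ is the set of all P-graphs over $P$. Given a non-empty set $W$ of worlds and a valuation $v:P\to 2^W$, $w\vDash\varphi$ denotes classical satisfaction of $\varphi$ at $w$ (with $w\vDash p$ iff $w\in v(p)$). The relation $\leq_G$ on $W$ is: $w\leq_G w'$ iff for every $\varphi\in\Phi$, either ($w'\vDash\varphi$ implies $w\vDash\varphi$), or there is $\psi\in\Phi$ with $\psi\prec\varphi$, $w\vDash\psi$ and $w'\not\vDash\psi$. Preference model: $M=\langle W,\leq,v\rangle$ with $W$ a non-empty set, $v:P\to 2^W$, and $\leq$ a reflexive transitive relation on $W$ whose strict part $<$ ($w<w'$ iff $w\leq w'$ and not $w'\leq w$) is well-founded. $M$ is induced by a P-graph $G$ iff $\leq\;=\;\leq_G$ (computed with $W$ and $v$). Dynamic operator: a function $\star$ mapping each pair (preference model $\langle W,\leq,v\rangle$, formula $\varphi\in\mathcal{L}_0(P)$) to a preference model $\langle W,\leq_{\star\varphi},v\rangle$ with the same $W$ and $v$. P-graph transformation: any function $\dagger:\mathbb{G}(P)\times\mathcal{L}_0(P)\to\mathbb{G}(P)$. A dynamic operator $\star$ is induced by $\dagger$ if for all preference models $M$, P-graphs $G$ and formulas $\varphi\in\mathcal{L}_0(P)$: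 if $M$ is induced by $G$ then $\star(M,\varphi)$ is induced by $\dagger(G,\varphi)$. $\dagger$ is relevant if some dynamic operator is induced by it. *)

theory Defs
  imports Main "HOL-Library.FuncSet" "HOL-Library.Countable_Set"
begin

datatype (atoms: 'p) fm =
    Atom 'p
  | Bot
  | Neg "'p fm"
  | And "'p fm" "'p fm"
  | Or "'p fm" "'p fm"
  | Imp "'p fm" "'p fm"

definition L0 :: "'p set \<Rightarrow> 'p fm set" where
  "L0 P = {\<phi>. atoms \<phi> \<subseteq> P}"

primrec fm_eval :: "('p \<Rightarrow> bool) \<Rightarrow> 'p fm \<Rightarrow> bool" where
  "fm_eval e (Atom p) \<longleftrightarrow> e p"
| "fm_eval e Bot \<longleftrightarrow> False"
| "fm_eval e (Neg \<phi>) \<longleftrightarrow> \<not> fm_eval e \<phi>"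
| "fm_eval e (And \<phi> \<psi>) \<longleftrightarrow> fm_eval e \<phi> \<and> fm_eval e \<psi>"
| "fm_eval e (Or \<phi> \<psi>) \<longleftrightarrow> fm_eval e \<phi> \<or> fm_eval e \<psi>"
| "fm_eval e (Imp \<phi> \<psi>) \<longleftrightarrow> (fm_eval e \<phi> \<longrightarrow> fm_eval e \<psi>)"

definition entails :: "'p fm \<Rightarrow> 'p fm \<Rightarrow> bool" where
  "entails \<phi> \<psi> \<longleftrightarrow> (\<forall>e. fm_eval e \<phi> \<longrightarrow> fm_eval e \<psi>)"

definition equivalent :: "'p fm \<Rightarrow> 'p fm \<Rightarrow> bool" where
  "equivalent \<phi> \<psi> \<longleftrightarrow> (\<forall>e. fm_eval e \<phi> \<longleftrightarrow> fm_eval e \<psi>)"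

definition sat :: "('p \<Rightarrow> 'w set) \<Rightarrow> 'w \<Rightarrow> 'p fm \<Rightarrow> bool" where
  "sat v w \<phi> \<longleftrightarrow> fm_eval (\<lambda>p. w \<in> v p) \<phi>"

(* (\<psi>, \<phi>) \<in> prec G stands for \<psi> \<prec> \<phi>. *)
record 'p pgraph =
  nodes :: "'p fm set"
  prec :: "('p fm \<times> 'p fm) set"

definition pgraphs :: "'p set \<Rightarrow> 'p pgraph set" where
  "pgraphs P = {G. nodes G \<subseteq> L0 P \<and> prec G \<subseteq> nodes G \<times> nodes G \<and> irrefl (prec G) \<and> trans (prec G)}"

definition pgraph_le :: "'p pgraph \<Rightarrow> 'w set \<Rightarrow> ('p \<Rightarrow> 'w set) \<Rightarrow> ('w \<times> 'w) set" where
  "pgraph_le G W v =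
    {(w, w'). w \<in> W \<and> w' \<in> W \<and>
      (\<forall>\<phi>\<in>nodes G.
        (sat v w' \<phi> \<longrightarrow> sat v w \<phi>) \<or>
        (\<exists>\<psi>\<in>nodes G. (\<psi>, \<phi>) \<in> prec G \<and> sat v w \<psi> \<and> \<not> sat v w' \<psi>))}"

(* (w, w') \<in> pref M stands for w \<le> w'. *)
record ('p, 'w) pref_model =
  worlds :: "'w set"
  pref :: "('w \<times> 'w) set"
  val :: "'p \<Rightarrow> 'w set"

(* The extensional function space makes a valuation on P a unique HOL function,
   so that equality of models is not affected by values outside P. *)
definition pref_models :: "'p set \<Rightarrow> ('p, 'w) pref_model set" where
  "pref_models P =
    {M. worlds M \<noteq> {} \<and>
        val M \<in> (P \<rightarrow>\<^sub>E Pow (worlds M)) \<and>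
        preorder_on (worlds M) (pref M) \<and>
        wf {(w, w'). (w, w') \<in> pref M \<and> (w', w) \<notin> pref M}}"

definition model_induced_by :: "('p, 'w) pref_model \<Rightarrow> 'p pgraph \<Rightarrow> bool" where
  "model_induced_by M G \<longleftrightarrow> pref M = pgraph_le G (worlds M) (val M)"

definition dynamic_operator ::
  "'p set \<Rightarrow> (('p, 'w) pref_model \<Rightarrow> 'p fm \<Rightarrow> ('p, 'w) pref_model) \<Rightarrow> bool" where
  "dynamic_operator P star \<longleftrightarrow>
    (\<forall>M\<in>pref_models P. \<forall>\<phi>\<in>L0 P.
      star M \<phi> \<in> pref_models P \<and> worlds (star M \<phi>) = worlds M \<and> val (star M \<phi>) = val M)"

definition pgraph_transformation :: "'p set \<Rightarrow> ('p pgraph \<Rightarrow> 'p fm \<Rightarrow> 'p pgraph) \<Rightarrow> bool" where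
  "pgraph_transformation P dag \<longleftrightarrow> dag \<in> pgraphs P \<rightarrow> L0 P \<rightarrow> pgraphs P"

definition operator_induced_by ::
  "'p set \<Rightarrow> (('p, 'w) pref_model \<Rightarrow> 'p fm \<Rightarrow> ('p, 'w) pref_model) \<Rightarrow>
    ('p pgraph \<Rightarrow> 'p fm \<Rightarrow> 'p pgraph) \<Rightarrow> bool" where
  "operator_induced_by P star dag \<longleftrightarrow>
    (\<forall>M\<in>pref_models P. \<forall>G\<in>pgraphs P. \<forall>\<phi>\<in>L0 P.
      model_induced_by M G \<longrightarrow> model_induced_by (star M \<phi>) (dag G \<phi>))"

(* The type argument fixes the universe from which sets of worlds are drawn.
   An operator on models over arbitrary sets of worlds restricts to each such universe. *)
definition relevant ::
  "'w itself \<Rightarrow> 'p set \<Rightarrow> ('p pgraph \<Rightarrow> 'p fm \<Rightarrow> 'p pgraph) \<Rightarrow> bool" where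
  "relevant (_ :: 'w itself) P dag \<longleftrightarrow>
    (\<exists>star :: ('p, 'w) pref_model \<Rightarrow> 'p fm \<Rightarrow> ('p, 'w) pref_model.
      dynamic_operator P star \<and> operator_induced_by P star dag)"

definition satisfies_DP4 ::
  "'w itself \<Rightarrow> 'p set \<Rightarrow> ('p pgraph \<Rightarrow> 'p fm \<Rightarrow> 'p pgraph) \<Rightarrow> bool" where
  "satisfies_DP4 (_ :: 'w itself) P dag \<longleftrightarrow>
    (\<forall>star :: ('p, 'w) pref_model \<Rightarrow> 'p fm \<Rightarrow> ('p, 'w) pref_model.
      dynamic_operator P star \<and> operator_induced_by P star dag \<longrightarrow>
      (\<forall>M\<in>pref_models P. (\<exists>G\<in>pgraphs P. model_induced_by M G) \<longrightarrow>
        (\<forall>\<phi>\<in>L0 P. \<forall>w\<in>worlds M. \<forall>w'\<in>worlds M.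
          sat (val M) w \<phi> \<and> \<not> sat (val M) w' \<phi> \<longrightarrow>
          (w, w') \<in> pref M \<longrightarrow> (w, w') \<in> pref (star M \<phi>))))"

end

theory Submission
  imports Defs
begin

text \<open>Let \<open>w\<close> satisfy \<phi> and \<open>w'\<close> falsify it. Then (a) says that
  truth of \<xi>' at \<open>w\<close> carries over to \<xi>, and (b) that truth of \<xi> at
  \<open>w'\<close> carries back to \<xi>'. Replacing \<xi>' by \<xi> can thus only favour
  \<open>w\<close> over \<open>w'\<close>, and by (c) the same holds for the nodes of higher
  priority that excuse a failure at \<xi>'. So every node of the new graph admits \<open>w\<close>
  below \<open>w'\<close>; this is \<open>pgraph_le_transfer\<close>. Being induced by the
  transformation turns it into a statement about the operator.\<close>

lemma sat_And [simp]: "sat v w (And \<phi> \<psi>) \<longleftrightarrow> sat v w \<phi> \<and> sat v w \<psi>"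
  by (simp add: sat_def)

lemma sat_Neg [simp]: "sat v w (Neg \<phi>) \<longleftrightarrow> \<not> sat v w \<phi>"
  by (simp add: sat_def)

lemma sat_entails: "entails \<phi> \<psi> \<Longrightarrow> sat v w \<phi> \<Longrightarrow> sat v w \<psi>"
  by (simp add: sat_def entails_def)

lemma sat_equivalent: "equivalent \<phi> \<psi> \<Longrightarrow> sat v w \<phi> \<longleftrightarrow> sat v w \<psi>"
  by (simp add: sat_def equivalent_def)

text \<open>The semantic core, free of operators: both orders are computed over the same
  \<open>W\<close> and \<open>v\<close>, and \<open>H\<close> stands for the transformed graph. Each
  node of \<open>H\<close> inherits from its partner \<xi>' in \<open>G\<close> whichever disjunct
  of the order holds there.\<close>

lemma pgraph_le_transfer:
  assumes le: "(w, w') \<in> pgraph_le G W v"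
    and w: "sat v w \<phi>" and w': "\<not> sat v w' \<phi>"
    and nodes: "\<And>\<xi>. \<xi> \<in> nodes H \<Longrightarrow>
      equivalent \<xi> \<phi> \<or>
      (\<exists>\<xi>'\<in>nodes G.
        entails (And \<phi> \<xi>') \<xi> \<and>
        entails (And (Neg \<phi>) \<xi>) \<xi>' \<and>
        (\<forall>\<psi>'\<in>nodes G. (\<psi>', \<xi>') \<in> prec G \<longrightarrow>
          (\<exists>\<psi>\<in>nodes H.
            entails (And \<phi> \<psi>') \<psi> \<and>
            entails (And (Neg \<phi>) \<psi>) \<psi>' \<and>
            (\<psi>, \<xi>) \<in> prec H)))"
  shows "(w, w') \<in> pgraph_le H W v"
proof -
  \<comment> \<open>\<open>up\<close> reads (a) at \<open>w\<close>, where \<phi> holds;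
    \<open>down\<close> reads (b) at \<open>w'\<close>, where \<open>Neg \<phi>\<close>
    holds.\<close>
  have up: "sat v w \<beta>" if "entails (And \<phi> \<alpha>) \<beta>" "sat v w \<alpha>" for \<alpha> \<beta>
    using sat_entails[OF that(1), of v w] that(2) w by simp
  have down: "sat v w' \<beta>" if "entails (And (Neg \<phi>) \<alpha>) \<beta>" "sat v w' \<alpha>" for \<alpha> \<beta>
    using sat_entails[OF that(1), of v w'] that(2) w' by simp
  have "(sat v w' \<xi> \<longrightarrow> sat v w \<xi>) \<or>
      (\<exists>\<psi>\<in>nodes H. (\<psi>, \<xi>) \<in> prec H \<and> sat v w \<psi> \<and> \<not> sat v w' \<psi>)"
    if \<xi>: "\<xi> \<in> nodes H" for \<xi>
    using nodes[OF \<xi>]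
  proof (elim disjE bexE conjE)
    assume "equivalent \<xi> \<phi>"
    then show ?thesis using w by (simp add: sat_equivalent)
  next
    fix \<xi>'
    assume \<xi>': "\<xi>' \<in> nodes G"
      and a: "entails (And \<phi> \<xi>') \<xi>" and b: "entails (And (Neg \<phi>) \<xi>) \<xi>'"
      and c: "\<forall>\<psi>'\<in>nodes G. (\<psi>', \<xi>') \<in> prec G \<longrightarrow>
          (\<exists>\<psi>\<in>nodes H.
            entails (And \<phi> \<psi>') \<psi> \<and>
            entails (And (Neg \<phi>) \<psi>) \<psi>' \<and>
            (\<psi>, \<xi>) \<in> prec H)"
    from le \<xi>' consider
        "sat v w' \<xi>' \<longrightarrow> sat v w \<xi>'"
      | \<psi>' where "\<psi>' \<in> nodes G" "(\<psi>', \<xi>') \<in> prec G" "sat v w \<psi>'" "\<not> sat v w' \<psi>'"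
      by (auto simp: pgraph_le_def)
    then show ?thesis
    proof cases
      case 1
      \<comment> \<open>Chain: \<xi> at \<open>w'\<close>, \<xi>' at \<open>w'\<close>, \<xi>' at
        \<open>w\<close>, \<xi> at \<open>w\<close>.\<close>
      then show ?thesis using up[OF a] down[OF b] by blast
    next
      case 2
      \<comment> \<open>The \<psi> that (c) assigns to \<psi>' is the witness: \<open>up\<close>
        makes it true at \<open>w\<close>, and \<open>down\<close>, contraposed, makes it false at
        \<open>w'\<close>.\<close>
      then show ?thesis using c up down by meson
    qed
  qed
  \<comment> \<open>\<open>le\<close> also supplies membership of both worlds in
    \<open>W\<close>.\<close>
  with le show ?thesis by (simp add: pgraph_le_def)
qed

theorem proposition14:
  fixes P :: "'p set"
    and dag :: "'p pgraph \<Rightarrow> 'p fm \<Rightarrow> 'p pgraph"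
  assumes "countable P"
    and "pgraph_transformation P dag"
    and "relevant TYPE('w) P dag"
    and "\<And>G \<phi> \<xi>. \<lbrakk>G \<in> pgraphs P; \<phi> \<in> L0 P; \<xi> \<in> nodes (dag G \<phi>)\<rbrakk> \<Longrightarrow>
      equivalent \<xi> \<phi> \<or>
      (\<exists>\<xi>'\<in>nodes G.
        entails (And \<phi> \<xi>') \<xi> \<and>
        entails (And (Neg \<phi>) \<xi>) \<xi>' \<and>
        (\<forall>\<psi>'\<in>nodes G. (\<psi>', \<xi>') \<in> prec G \<longrightarrow>
          (\<exists>\<psi>\<in>nodes (dag G \<phi>).
            entails (And \<phi> \<psi>') \<psi> \<and>
            entails (And (Neg \<phi>) \<psi>) \<psi>' \<and>
            (\<psi>, \<xi>) \<in> prec (dag G \<phi>))))"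
  shows "satisfies_DP4 TYPE('w) P dag"
  unfolding satisfies_DP4_def
proof (intro allI impI ballI, elim conjE bexE)
  fix star :: "('p, 'w) pref_model \<Rightarrow> 'p fm \<Rightarrow> ('p, 'w) pref_model"
    and M :: "('p, 'w) pref_model" and \<phi> w w' G
  assume star: "dynamic_operator P star" "operator_induced_by P star dag"
    and M: "M \<in> pref_models P" and G: "G \<in> pgraphs P" "model_induced_by M G"
    and \<phi>: "\<phi> \<in> L0 P"
    and sat: "sat (val M) w \<phi>" "\<not> sat (val M) w' \<phi>"
    and le: "(w, w') \<in> pref M"
  have "(w, w') \<in> pgraph_le G (worlds M) (val M)"
    using le G(2) by (simp add: model_induced_by_def)
  then have "(w, w') \<in> pgraph_le (dag G \<phi>) (worlds M) (val M)"
    using sat assms(4)[OF G(1) \<phi>] by (rule pgraph_le_transfer)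
  \<comment> \<open>A dynamic operator keeps worlds and valuation, so the order induced by
    \<open>dag G \<phi>\<close> on \<open>star M \<phi>\<close> is the one computed from
    \<open>M\<close>.\<close>
  moreover have "pref (star M \<phi>) = pgraph_le (dag G \<phi>) (worlds M) (val M)"
    using star M G \<phi>
    by (simp add: dynamic_operator_def operator_induced_by_def model_induced_by_def)
  ultimately show "(w, w') \<in> pref (star M \<phi>)" by simp
qed

end
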